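(* Let $r$ be a positive integer. If $r$ is odd, then \[ \log L_r = \sum_{k = 0}^\infty {\frac{1}{{\alpha ^{2rk} }}\sum_{j = 1}^{r - 1} {\frac{{\beta ^{2j}\, r}}{{rk + j}}} }. \] If $r$ is even, then \[ \log L_r = \sum_{k = 0}^\infty {\frac{1}{{\alpha ^{4rk} }}\sum_{j = 1}^{2r - 1} {\frac{{\beta ^{2j}\, r\,(1 + \delta _{r,j} )}}{{2rk + j}}} }. \]
   Context: $\alpha=(1+\sqrt5)/2$ is the golden ratio and $\beta=-1/\alpha=(1-\sqrt5)/2$. The Lucas numbers are $L_n=\alpha^n+\beta^n$. $\delta_{m,n}$ is the Kronecker delta (equal to $1$ if $m=n$ and $0$ otherwise); $\log$ is the natural logarithm. *)

theory Defs
  imports Complex_Main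
begin

definition alpha :: real where
  "alpha = (1 + sqrt 5) / 2"

definition beta :: real where
  "beta = - 1 / alpha"

lemma beta_eq: "beta = (1 - sqrt 5) / 2"
proof -
  have "(1 + sqrt 5) * (1 - sqrt 5) = - (4 :: real)"
    by (simp add: algebra_simps)
  moreover have "1 + sqrt 5 > (0 :: real)"
    by (simp add: add_pos_nonneg)
  ultimately show ?thesis
    by (simp add: beta_def alpha_def field_simps)
qed

text \<open>Lucas numbers, given by their Binet formula and regarded as real numbers.\<close>

definition lucas :: "nat \<Rightarrow> real" where
  "lucas n = alpha ^ n + beta ^ n"

definition kronecker_delta :: "nat \<Rightarrow> nat \<Rightarrow> real" where
  "kronecker_delta m n = (if m = n then 1 else 0)"

end

theory Submission
  imports Defs "HOL-Analysis.Complex_Transcendental"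
begin

text \<open>
  Put \<open>x = \<beta>\<^sup>2 = 1 / \<alpha>\<^sup>2\<close>, so that \<open>1 - x = 1 / \<alpha>\<close>. Deleting the
  terms whose index is a multiple of \<open>N\<close> from the series of \<open>- ln (1 - x)\<close> and grouping
  the others into blocks adds \<open>ln (1 - x ^ N) / N\<close> to the sum. For odd \<open>r\<close>,
  \<open>L\<^sub>r = \<alpha> ^ r * (1 - x ^ r)\<close> and one takes \<open>N = r\<close>. For even \<open>r\<close>,
  \<open>L\<^sub>r = \<alpha> ^ r * (1 + x ^ r)\<close>; one takes \<open>N = 2 * r\<close>, and the Kronecker delta
  contributes the same deleted series at \<open>x ^ r\<close> with \<open>N = 2\<close>.
\<close>

lemma log_series_without_multiples:
  fixes x :: real
  assumes "\<bar>x\<bar> < 1" "N > 0"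
  shows "(\<lambda>k. \<Sum>j = 1..N - 1. x ^ (N * k + j) / real (N * k + j))
           sums (- ln (1 - x) + ln (1 - x ^ N) / real N)"
proof -
  \<comment> \<open>Starting at \<open>n = 0\<close> is harmless: division by zero yields 0, so that
    term vanishes.\<close>
  have series: "(\<lambda>n. y ^ n / real n) sums - ln (1 - y)" if "\<bar>y\<bar> < 1" for y :: real
    using sums_minus[OF ln_series'[of "- y"]] that by simp
  let ?f = "\<lambda>n. x ^ n / real n"
  \<comment> \<open>Each block of \<open>N\<close> consecutive indices contains one multiple of
    \<open>N\<close>, its first index; for \<open>k = 0\<close> the removed term is again 0.\<close>
  have block: "sum ?f {k * N..<k * N + N} - (x ^ N) ^ k / real k / real N
               = (\<Sum>j = 1..N - 1. ?f (N * k + j))" for k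
  proof -
    have "sum ?f {k * N..<k * N + N} = (\<Sum>j = 0..<N. ?f (N * k + j))"
      using sum.shift_bounds_nat_ivl[of ?f 0 "k * N" N] by (simp add: ac_simps)
    also have "\<dots> = ?f (N * k) + (\<Sum>j = 1..<N. ?f (N * k + j))"
      using assms(2) by (simp add: sum.atLeast_Suc_lessThan)
    also have "{1..<N} = {1..N - 1}"
      by auto
    finally show ?thesis
      by (simp add: power_mult mult.commute)
  qed
  have "\<bar>x ^ N\<bar> < 1"
    using assms by (simp add: power_abs power_less_one_iff)
  then have "(\<lambda>k. (x ^ N) ^ k / real k / real N) sums (- ln (1 - x ^ N) / real N)"
    by (intro sums_divide series)
  from sums_diff[OF sums_group[OF series[OF assms(1)] assms(2)] this]
  show ?thesis
    by (simp only: block) simp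
qed

lemma alpha_gt_1: "alpha > 1"
  unfolding alpha_def using real_less_rsqrt[of 1 5] by simp

text \<open>\<open>beta\<close> is a root of \<open>t^2 = t + 1\<close>.\<close>

lemma one_minus_beta_sq: "1 - beta\<^sup>2 = 1 / alpha"
proof -
  have "1 - beta\<^sup>2 = - beta"
    by (simp add: beta_eq power2_eq_square field_simps)
  then show ?thesis
    by (simp add: beta_def)
qed

lemma beta_sq: "beta\<^sup>2 = 1 / alpha\<^sup>2"
  by (simp add: beta_def power_divide)

lemma beta_sq_bounds: "0 < beta\<^sup>2" "beta\<^sup>2 < 1"
  using alpha_gt_1 by (simp_all add: beta_sq)

text \<open>From \<open>alpha * beta = -1\<close>, \<open>beta\<close> is
  \<open>- alpha * beta^2\<close>; the parity of \<open>r\<close> then fixes the sign.\<close>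

lemma lucas_factor: "lucas r = alpha ^ r * (1 + (- 1) ^ r * (beta\<^sup>2) ^ r)"
proof -
  have "beta = alpha * (- 1 * beta\<^sup>2)"
    using alpha_gt_1 by (simp add: beta_def power2_eq_square)
  then have "beta ^ r = alpha ^ r * ((- 1) ^ r * (beta\<^sup>2) ^ r)"
    by (metis power_mult_distrib)
  then show ?thesis
    by (simp add: lucas_def algebra_simps)
qed

text \<open>Turns the weights of the theorem into powers of \<open>x\<close>, with
  \<open>m = r * k\<close> or \<open>m = 2 * r * k\<close>.\<close>

lemma beta_power_block:
  "1 / alpha ^ (2 * m) * beta ^ (2 * j) = (beta\<^sup>2) ^ (m + j)"
  by (simp add: power_add power_mult beta_sq power_divide)

theorem theorem2p4:
  fixes r :: nat
  assumes "r > 0"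
  shows "(odd r \<longrightarrow>
           (\<lambda>k::nat. 1 / alpha ^ (2 * r * k) *
              (\<Sum>j = 1..r - 1. beta ^ (2 * j) * real r / (real r * real k + real j)))
           sums ln (lucas r)) \<and>
         (even r \<longrightarrow>
           (\<lambda>k::nat. 1 / alpha ^ (4 * r * k) *
              (\<Sum>j = 1..2 * r - 1. beta ^ (2 * j) * real r * (1 + kronecker_delta r j)
                                  / (2 * real r * real k + real j)))
           sums ln (lucas r))"
proof (intro conjI impI)
  define x where "x = beta\<^sup>2"
  have x: "0 < x" "x < 1" "\<bar>x\<bar> < 1" and ln_x: "- ln (1 - x) = ln alpha"
    using beta_sq_bounds alpha_gt_1 by (simp_all add: x_def one_minus_beta_sq ln_div)
  have y: "0 < x ^ r" "x ^ r < 1" "\<bar>x ^ r\<bar> < 1"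
    using x assms by (simp_all add: power_less_one_iff)
  {
    assume "odd r"
    have "real r * (- ln (1 - x) + ln (1 - x ^ r) / real r) = ln (lucas r)"
      using \<open>odd r\<close> assms alpha_gt_1 y
      by (simp add: ln_x lucas_factor x_def[symmetric] ln_mult ln_realpow distrib_left)
    moreover have "real r * (\<Sum>j = 1..r - 1. x ^ (r * k + j) / real (r * k + j))
        = 1 / alpha ^ (2 * r * k) *
          (\<Sum>j = 1..r - 1. beta ^ (2 * j) * real r / (real r * real k + real j))" for k
      unfolding sum_distrib_left
      by (intro sum.cong refl)
         (simp add: x_def beta_power_block[symmetric] mult.assoc)
    ultimately show "(\<lambda>k::nat. 1 / alpha ^ (2 * r * k) *
              (\<Sum>j = 1..r - 1. beta ^ (2 * j) * real r / (real r * real k + real j)))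
           sums ln (lucas r)"
      using sums_mult[OF log_series_without_multiples[OF x(3) assms], of "real r"] by simp
  next
    assume "even r"
    have "2 * r > 0"
      using assms by simp
    have "ln (1 - x ^ (2 * r)) = ln ((1 - x ^ r) * (1 + x ^ r))"
      by (simp add: distrib_left left_diff_distrib mult_2 power_add)
    also have "\<dots> = ln (1 - x ^ r) + ln (1 + x ^ r)"
      using y by (simp add: ln_mult)
    finally have ln_diff_sq: "ln (1 - x ^ (2 * r)) = ln (1 - x ^ r) + ln (1 + x ^ r)" .
    \<comment> \<open>Each of the two series contributes half of
      \<open>ln (1 - x ^ (2 * r))\<close>; the term \<open>- ln (1 - x ^ r)\<close> then leaves only
      \<open>ln (1 + x ^ r)\<close> beside \<open>r * ln alpha\<close>.\<close>
    have "real r * (- ln (1 - x) + ln (1 - x ^ (2 * r)) / real (2 * r))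
          + (- ln (1 - x ^ r) + ln (1 - (x ^ r) ^ 2) / real 2) = ln (lucas r)"
    proof -
      have "ln (lucas r) = real r * ln alpha + ln (1 + x ^ r)"
        using \<open>even r\<close> alpha_gt_1 y
        by (simp add: lucas_factor x_def[symmetric] ln_mult ln_realpow add_pos_pos)
      moreover have "(x ^ r) ^ 2 = x ^ (2 * r)"
        by (simp add: power_mult[symmetric] mult.commute)
      ultimately show ?thesis
        using assms by (simp only: ln_x ln_diff_sq) (simp add: field_simps)
    qed
    moreover have "real r * (\<Sum>j = 1..2 * r - 1. x ^ (2 * r * k + j) / real (2 * r * k + j))
          + (\<Sum>j = 1..2 - 1. (x ^ r) ^ (2 * k + j) / real (2 * k + j))
        = 1 / alpha ^ (4 * r * k) *
          (\<Sum>j = 1..2 * r - 1. beta ^ (2 * j) * real r * (1 + kronecker_delta r j)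
                              / (2 * real r * real k + real j))" for k
    proof -
      let ?t = "\<lambda>j. real r * (x ^ (2 * r * k + j) / real (2 * r * k + j))"
      have "(\<Sum>j = 1..2 - 1. (x ^ r) ^ (2 * k + j) / real (2 * k + j))
          = (x ^ r) ^ (2 * k + 1) / real (2 * k + 1)"
        by simp
      \<comment> \<open>Expanding the fraction by \<open>r\<close> turns the odd index
        \<open>2 * k + 1\<close> into the middle index \<open>j = r\<close> of the
        \<open>k\<close>-th block of length \<open>2 * r\<close>.\<close>
      also have "\<dots> = x ^ (r * (2 * k + 1)) * real r / real (r * (2 * k + 1))"
        using assms by (simp only: power_mult of_nat_mult) simp
      also have "r * (2 * k + 1) = 2 * r * k + r"
        by simp
      also have "x ^ (2 * r * k + r) * real r / real (2 * r * k + r) = ?t r"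
        by simp
      \<comment> \<open>As \<open>r > 0\<close>, the index \<open>r\<close> lies in the range of
        summation.\<close>
      also have "\<dots> = (\<Sum>j = 1..2 * r - 1. ?t j * kronecker_delta r j)"
        using assms by (simp add: kronecker_delta_def if_distrib sum.delta' cong: if_cong)
      finally have "real r * (\<Sum>j = 1..2 * r - 1. x ^ (2 * r * k + j) / real (2 * r * k + j))
          + (\<Sum>j = 1..2 - 1. (x ^ r) ^ (2 * k + j) / real (2 * k + j))
        = (\<Sum>j = 1..2 * r - 1. ?t j * (1 + kronecker_delta r j))"
        by (simp only: sum_distrib_left distrib_left mult_1_right sum.distrib)
      also have "\<dots> = 1 / alpha ^ (2 * (2 * r * k)) *
          (\<Sum>j = 1..2 * r - 1. beta ^ (2 * j) * real r * (1 + kronecker_delta r j)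
                              / (2 * real r * real k + real j))"
        unfolding sum_distrib_left x_def beta_power_block[symmetric]
        by (intro sum.cong refl) simp
      finally show ?thesis
        by (simp add: mult.assoc)
    qed
    ultimately show "(\<lambda>k::nat. 1 / alpha ^ (4 * r * k) *
              (\<Sum>j = 1..2 * r - 1. beta ^ (2 * j) * real r * (1 + kronecker_delta r j)
                                  / (2 * real r * real k + real j)))
           sums ln (lucas r)"
      using sums_add[OF
          sums_mult[OF log_series_without_multiples[OF x(3) \<open>2 * r > 0\<close>], of "real r"]
          log_series_without_multiples[OF y(3) pos2]]
      by (simp only:)
  }
qed

end
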